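(* For any connected graph $G$ with middle graph $M(G)$, $\gamma_p(M(G))=1$ if and only if $G$ has one universal edge, i.e. an edge that is adjacent to all other edges of $G$.
   Context: All graphs are finite, simple and undirected. $N[v]$ denotes the closed neighborhood of $v$ and $N[S]=\bigcup_{v\in S}N[v]$. For $U\subseteq V(G)$, the closure $cl(U)$ is the set obtained from $U$ by repeatedly applying, until no more changes are possible, the rule: if a vertex $u$ is in the current set and exactly one neighbor $w$ of $u$ is not in it, then add $w$. A set $S\subseteq V(G)$ is a power dominating set of $G$ if $cl(N[S])=V(G)$, and the power domination number $\gamma_p(G)$ is the minimum cardinality of a power dominating set. The middle graph $M(G)$ of a graph $G$ has vertex set $V(G)\cup E(G)$, where two vertices of $M(G)$ are adjacent if and only if either they are adjacent edges of $G$ (distinct edges sharing an endpoint), or one is a vertex of $G$ and the other is an edge of $G$ incident with it. "Has one universal edge" is used in the sense of having at least one such edge.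
   Formalization: The connected graph G is assumed to have at least two vertices; for the one-vertex graph the claim fails, since its middle graph is a single vertex with power domination number 1 while G has no edge at all. *)

theory Defs
  imports "Graph_Theory.Graph_Theory"
begin

text \<open>
  A finite simple undirected graph is a \<^locale>\<open>pair_graph\<close>: a finite, loopfree, symmetric digraph
  without parallel arcs, so each undirected edge is a pair of opposite arcs. The edges proper are
  recovered as the two-element sets of endpoints, so that an edge is a single object (and a single
  vertex of the middle graph).
\<close>

definition uedges :: "'a pair_pre_digraph \<Rightarrow> 'a set set" where
  "uedges G = {{u, v} | u v. (u, v) \<in> parcs G}"

definition adjacent_edges :: "'a set \<Rightarrow> 'a set \<Rightarrow> bool" where
  "adjacent_edges e f \<longleftrightarrow> e \<noteq> f \<and> e \<inter> f \<noteq> {}"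

definition universal_edge :: "'a pair_pre_digraph \<Rightarrow> 'a set \<Rightarrow> bool" where
  "universal_edge G e \<longleftrightarrow> e \<in> uedges G \<and> (\<forall>f\<in>uedges G. f \<noteq> e \<longrightarrow> adjacent_edges e f)"

definition middle_graph :: "'a pair_pre_digraph \<Rightarrow> ('a + 'a set) pair_pre_digraph" where
  "middle_graph G = \<lparr>
     pverts = Inl ` pverts G \<union> Inr ` uedges G,
     parcs = {(Inr e, Inr f) | e f. e \<in> uedges G \<and> f \<in> uedges G \<and> adjacent_edges e f}
           \<union> {(Inl v, Inr e) | v e. v \<in> pverts G \<and> e \<in> uedges G \<and> v \<in> e}
           \<union> {(Inr e, Inl v) | v e. v \<in> pverts G \<and> e \<in> uedges G \<and> v \<in> e} \<rparr>"

definition nbhd :: "'a pair_pre_digraph \<Rightarrow> 'a \<Rightarrow> 'a set" where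
  "nbhd G v = {w. (v, w) \<in> parcs G}"

definition closed_nbhd :: "'a pair_pre_digraph \<Rightarrow> 'a \<Rightarrow> 'a set" where
  "closed_nbhd G v = insert v (nbhd G v)"

inductive force_step :: "'a pair_pre_digraph \<Rightarrow> 'a set \<Rightarrow> 'a set \<Rightarrow> bool" for G where
  "u \<in> A \<Longrightarrow> nbhd G u - A = {w} \<Longrightarrow> force_step G A (insert w A)"

text \<open>
  The closure is the final set of an exhaustive application of the rule, in any order;
  \<open>power_closure_unique\<close> below shows that it exists and is unique.
\<close>

definition exhausts :: "'a pair_pre_digraph \<Rightarrow> 'a set \<Rightarrow> 'a set \<Rightarrow> bool" where
  "exhausts G U C \<longleftrightarrow> (force_step G)\<^sup>*\<^sup>* U C \<and> (\<nexists>D. force_step G C D)"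

definition power_closure :: "'a pair_pre_digraph \<Rightarrow> 'a set \<Rightarrow> 'a set" where
  "power_closure G U = (THE C. exhausts G U C)"

definition power_dominating :: "'a pair_pre_digraph \<Rightarrow> 'a set \<Rightarrow> bool" where
  "power_dominating G S \<longleftrightarrow>
     S \<subseteq> pverts G \<and> power_closure G (\<Union>v\<in>S. closed_nbhd G v) = pverts G"

definition power_domination_number :: "'a pair_pre_digraph \<Rightarrow> nat" where
  "power_domination_number G = Min (card ` {S. power_dominating G S})"

lemma force_steps_subset_stuck:
  assumes "(force_step G)\<^sup>*\<^sup>* U A" "U \<subseteq> C" "\<nexists>D. force_step G C D"
  shows "A \<subseteq> C"
  using assms(1)
proof (induction rule: rtranclp_induct)
  case base
  then show ?case by (fact assms(2))
next
  case (step A B)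
  from step.hyps(2) obtain u w where uw: "u \<in> A" "nbhd G u - A = {w}" "B = insert w A"
    by (auto elim: force_step.cases)
  have "w \<in> C"
  proof (rule ccontr)
    assume "w \<notin> C"
    with uw step.IH have "nbhd G u - C = {w}" "u \<in> C" by auto
    with assms(3) show False by (auto intro: force_step.intros)
  qed
  with uw step.IH show ?case by auto
qed

lemma force_steps_mono: "(force_step G)\<^sup>*\<^sup>* U A \<Longrightarrow> U \<subseteq> A"
  by (induction rule: rtranclp_induct) (auto elim: force_step.cases)

lemma (in pair_fin_digraph) exhausts_exists: "\<exists>C. exhausts G U C"
proof (induction "card (snd ` parcs G - U)" arbitrary: U rule: less_induct)
  case less
  show ?case
  proof (cases "\<exists>D. force_step G U D")
    case False
    then show ?thesis unfolding exhausts_def by blast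
  next
    case True
    then obtain D where D: "force_step G U D" by blast
    then obtain u w where uw: "nbhd G u - U = {w}" "D = insert w U"
      by (auto elim: force_step.cases)
    then have "w \<in> nbhd G u" "w \<notin> U" by auto
    then have "w \<in> snd ` parcs G - U" by (force simp: nbhd_def)
    moreover have "w \<notin> snd ` parcs G - D" using uw by simp
    moreover have "snd ` parcs G - D \<subseteq> snd ` parcs G - U" using uw by auto
    ultimately have "snd ` parcs G - D \<subset> snd ` parcs G - U" by blast
    then have "card (snd ` parcs G - D) < card (snd ` parcs G - U)"
      using pair_finite_arcs by (intro psubset_card_mono) auto
    from less[OF this] obtain C where "exhausts G D C" by blast
    with D show ?thesis unfolding exhausts_def
      by (meson converse_rtranclp_into_rtranclp)
  qed
qed

lemma exhausts_unique: "exhausts G U C \<Longrightarrow> exhausts G U D \<Longrightarrow> C = D"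
  unfolding exhausts_def
  by (meson force_steps_mono force_steps_subset_stuck subset_antisym)

lemma (in pair_fin_digraph) power_closure_unique:
  "exhausts G U C \<longleftrightarrow> C = power_closure G U"
  using exhausts_exists[of U] exhausts_unique theI'[of "exhausts G U"]
  unfolding power_closure_def by metis

lemma (in pair_graph) middle_graph_pair_graph: "pair_graph (middle_graph G)"
proof -
  have fin: "finite (pverts (middle_graph G))"
  proof -
    have "uedges G = (\<lambda>(u, v). {u, v}) ` parcs G"
      by (force simp: uedges_def)
    then show ?thesis
      using pair_finite_arcs pair_finite_verts by (simp add: middle_graph_def)
  qed
  have sub: "parcs (middle_graph G) \<subseteq> pverts (middle_graph G) \<times> pverts (middle_graph G)"
    by (auto simp: middle_graph_def)
  have "sym (parcs (middle_graph G))"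
    by (auto simp: middle_graph_def adjacent_edges_def sym_def Int_commute)
  moreover have "\<And>x. (x, x) \<notin> parcs (middle_graph G)"
    by (auto simp: middle_graph_def adjacent_edges_def)
  ultimately show ?thesis
    using fin sub finite_subset[OF sub]
    by unfold_locales (auto simp: symmetric_def)
qed

end

theory Submission
  imports Defs
begin

text \<open>
  Call a set of vertices \<^emph>\<open>stuck\<close> if the forcing rule cannot enlarge it. A set \<open>S\<close> is power
  dominating iff every stuck set above \<open>N[S]\<close> contains all vertices
  (\<open>power_dominating_iff_stuck\<close>), so domination is refuted by exhibiting one proper stuck set.

  If \<open>e\<close> is a universal edge, then the closed neighbourhood of the vertex \<open>e\<close> of \<open>M(G)\<close> already
  contains all edges of \<open>G\<close> and both ends of \<open>e\<close>. Every further vertex \<open>w\<close> lies on an edge \<open>f\<close>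
  because \<open>G\<close> is connected, and \<open>w\<close> is forced by \<open>f\<close>, since the other end of \<open>f\<close> lies on \<open>e\<close>.

  Conversely, for any edge \<open>e\<close> consider the edges that meet \<open>e\<close> together with the vertices all of
  whose edges meet \<open>e\<close>. This set is stuck (\<open>stuck_meeting_region\<close>): an observed edge \<open>g\<close> that sees
  anything outside sees, for some vertex \<open>w\<close> on \<open>g\<close>, both \<open>w\<close> itself and an edge at \<open>w\<close> that misses
  \<open>e\<close>, hence at least two unobserved neighbours. It contains the closed neighbourhood in
  \<open>M(G)\<close> of \<open>e\<close> and of each end of \<open>e\<close>. Thus if some edge misses \<open>e\<close>, then neither \<open>e\<close> nor an
  end of \<open>e\<close> power dominates \<open>M(G)\<close>. Since every vertex of \<open>G\<close> lies on an edge, this covers all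
  single vertices of \<open>M(G)\<close>.
\<close>

section \<open>Power domination through stuck sets\<close>

definition stuck :: "'a pair_pre_digraph \<Rightarrow> 'a set \<Rightarrow> bool" where
  "stuck G C \<longleftrightarrow> (\<forall>u\<in>C. \<forall>w. nbhd G u - C \<noteq> {w})"

lemma stuck_iff_no_force_step: "stuck G C \<longleftrightarrow> (\<nexists>D. force_step G C D)"
  unfolding stuck_def by (auto elim!: force_step.cases intro: force_step.intros)

context pair_fin_digraph
begin

lemma closed_nbhd_subset_pverts: "v \<in> pverts G \<Longrightarrow> closed_nbhd G v \<subseteq> pverts G"
  by (auto simp: closed_nbhd_def nbhd_def dest: in_arcsD2)

lemma stuck_pverts: "stuck G (pverts G)"
  unfolding stuck_def nbhd_def by (auto dest: in_arcsD2)

text \<open>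
  The closure of \<open>U\<close> is the least stuck set above \<open>U\<close>: it is stuck itself, and no forcing sequence
  from \<open>U\<close> leaves a stuck set.
\<close>

lemma power_closure_subset_iff:
  "P \<subseteq> power_closure G U \<longleftrightarrow> (\<forall>C. U \<subseteq> C \<longrightarrow> stuck G C \<longrightarrow> P \<subseteq> C)"
proof -
  have "exhausts G U (power_closure G U)"
    using power_closure_unique by simp
  then have "U \<subseteq> power_closure G U" "stuck G (power_closure G U)"
    and "\<And>C. U \<subseteq> C \<Longrightarrow> stuck G C \<Longrightarrow> power_closure G U \<subseteq> C"
    by (auto simp: exhausts_def stuck_iff_no_force_step dest: force_steps_mono
        force_steps_subset_stuck)
  then show ?thesis by blast
qed

lemma power_dominating_iff_stuck:
  "power_dominating G S \<longleftrightarrow> S \<subseteq> pverts G \<and>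
     (\<forall>C. (\<Union>v\<in>S. closed_nbhd G v) \<subseteq> C \<longrightarrow> stuck G C \<longrightarrow> pverts G \<subseteq> C)"
proof (cases "S \<subseteq> pverts G")
  case True
  let ?U = "\<Union>v\<in>S. closed_nbhd G v"
  have "?U \<subseteq> pverts G"
    using True closed_nbhd_subset_pverts by blast
  then have "power_closure G ?U \<subseteq> pverts G"
    using power_closure_subset_iff[of "power_closure G ?U" ?U] stuck_pverts by blast
  then show ?thesis
    using True power_closure_subset_iff[of "pverts G" ?U]
    unfolding power_dominating_def by blast
qed (simp add: power_dominating_def)

text \<open>
  The whole vertex set is power dominating, so the minimum defining the power domination number is
  attained; the empty set is stuck, so on a nonempty graph that minimum is at least one.
\<close>

lemma power_domination_number_eq_1_iff:
  assumes "pverts G \<noteq> {}"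
  shows "power_domination_number G = 1 \<longleftrightarrow> (\<exists>v. power_dominating G {v})"
proof -
  let ?D = "{S. power_dominating G S}"
  have sub: "?D \<subseteq> Pow (pverts G)"
    by (auto simp: power_dominating_def)
  then have fin: "finite (card ` ?D)"
    using pair_finite_verts by (meson finite_Pow_iff finite_imageI finite_subset)
  have "power_dominating G (pverts G)"
    unfolding power_dominating_iff_stuck by (auto simp: closed_nbhd_def)
  then have ne: "card ` ?D \<noteq> {}" by blast
  have "\<not> power_dominating G {}"
    using assms unfolding power_dominating_iff_stuck by (auto simp: stuck_def)
  then have pos: "card S \<ge> 1" if "S \<in> ?D" for S
    using that sub pair_finite_verts
    by (metis One_nat_def PowD Suc_leI card_gt_0_iff finite_subset mem_Collect_eq subsetD)
  have "Min (card ` ?D) = 1 \<longleftrightarrow> 1 \<in> card ` ?D"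
    using Min_eq_iff[OF fin ne, of 1] pos by auto
  also have "\<dots> \<longleftrightarrow> (\<exists>S. power_dominating G S \<and> card S = Suc 0)"
    by (auto simp: image_iff eq_commute)
  also have "\<dots> \<longleftrightarrow> (\<exists>v. power_dominating G {v})"
    by (auto simp: card_1_singleton_iff)
  finally show ?thesis unfolding power_domination_number_def .
qed

end

section \<open>Neighbourhoods in the middle graph\<close>

lemma nbhd_middle_graph_vertex:
  "v \<in> pverts G \<Longrightarrow> nbhd (middle_graph G) (Inl v) = Inr ` {e \<in> uedges G. v \<in> e}"
  by (auto simp: nbhd_def middle_graph_def)

lemma nbhd_middle_graph_edge:
  "e \<in> uedges G \<Longrightarrow> nbhd (middle_graph G) (Inr e) =
     Inl ` (pverts G \<inter> e) \<union> Inr ` {f \<in> uedges G. adjacent_edges e f}"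
  by (auto simp: nbhd_def middle_graph_def)

lemma pverts_middle_graph: "pverts (middle_graph G) = Inl ` pverts G \<union> Inr ` uedges G"
  by (simp add: middle_graph_def)

context pair_graph
begin

lemma uedges_subset_pverts: "e \<in> uedges G \<Longrightarrow> e \<subseteq> pverts G"
  by (auto simp: uedges_def dest: in_arcsD1 in_arcsD2)

text \<open>An edge meets itself, so universality needs no case distinction on equality.\<close>

lemma universal_edge_iff_meets_all:
  "universal_edge G e \<longleftrightarrow> e \<in> uedges G \<and> (\<forall>f\<in>uedges G. f \<inter> e \<noteq> {})"
  by (auto simp: universal_edge_def adjacent_edges_def uedges_def)

lemma vertex_on_edge:
  assumes "connected G" "card (pverts G) \<ge> 2" "v \<in> pverts G"
  obtains e where "e \<in> uedges G" "v \<in> e"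
proof -
  have "\<not> pverts G \<subseteq> {v}"
    using assms(2) card_mono[of "{v}" "pverts G"] by auto
  then obtain w where w: "w \<in> pverts G" "w \<noteq> v" by blast
  have "strongly_connected G"
    using assms(1) pair_sym_arcs symmetric_connected_imp_strongly_connected by blast
  then have "v \<rightarrow>\<^sup>*\<^bsub>G\<^esub> w"
    using assms(3) w by (auto simp: strongly_connected_def)
  then obtain x where "(v, x) \<in> parcs G"
    using w(2) by (cases rule: converse_reachable_cases) auto
  then show thesis by (intro that[of "{v, x}"]) (auto simp: uedges_def)
qed

lemma closed_nbhd_edge_iff:
  assumes "e \<in> uedges G"
  shows "Inl v \<in> closed_nbhd (middle_graph G) (Inr e) \<longleftrightarrow> v \<in> e"
    and "Inr f \<in> closed_nbhd (middle_graph G) (Inr e) \<longleftrightarrow> f \<in> uedges G \<and> f \<inter> e \<noteq> {}"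
proof -
  note nb = closed_nbhd_def nbhd_middle_graph_edge[OF assms]
  show "Inl v \<in> closed_nbhd (middle_graph G) (Inr e) \<longleftrightarrow> v \<in> e"
    unfolding nb using uedges_subset_pverts[OF assms] by auto
  have "e \<noteq> {}" using assms by (auto simp: uedges_def)
  then show "Inr f \<in> closed_nbhd (middle_graph G) (Inr e) \<longleftrightarrow> f \<in> uedges G \<and> f \<inter> e \<noteq> {}"
    unfolding nb adjacent_edges_def using assms by auto
qed

section \<open>The stuck region around an edge\<close>

definition meeting_region :: "'a set \<Rightarrow> ('a + 'a set) set" where
  "meeting_region e = Inl ` {v \<in> pverts G. \<forall>f\<in>uedges G. v \<in> f \<longrightarrow> f \<inter> e \<noteq> {}}
     \<union> Inr ` {f \<in> uedges G. f \<inter> e \<noteq> {}}"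

lemma in_meeting_region_iff [simp]:
  "Inl v \<in> meeting_region e \<longleftrightarrow> v \<in> pverts G \<and> (\<forall>f\<in>uedges G. v \<in> f \<longrightarrow> f \<inter> e \<noteq> {})"
  "Inr f \<in> meeting_region e \<longleftrightarrow> f \<in> uedges G \<and> f \<inter> e \<noteq> {}"
  by (auto simp: meeting_region_def)

text \<open>
  The neighbours of an edge outside the region come in groups: an outside end \<open>w\<close> brings along the
  edge at \<open>w\<close> that keeps it outside, and an outside edge brings along its common end with the
  observed edge. So there is never exactly one.
\<close>

lemma stuck_meeting_region: "stuck (middle_graph G) (meeting_region e)"
  unfolding stuck_def
proof (intro ballI allI notI)
  fix x y
  assume x: "x \<in> meeting_region e"
    and y: "nbhd (middle_graph G) x - meeting_region e = {y}"
  show False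
  proof (cases x)
    case (Inl v)
    then have "nbhd (middle_graph G) x \<subseteq> meeting_region e"
      using x by (auto simp: nbhd_middle_graph_vertex)
    then show False using y by blast
  next
    case (Inr g)
    with x have g: "g \<in> uedges G" "g \<inter> e \<noteq> {}"
      by auto
    note nb = nbhd_middle_graph_edge[OF g(1)]
    have y_out: "y \<in> nbhd (middle_graph G) (Inr g)" "y \<notin> meeting_region e"
      using y Inr by auto
    obtain w f where "w \<in> pverts G" "w \<in> g" "w \<in> f" "f \<in> uedges G" "f \<inter> e = {}"
    proof (cases y)
      case (Inl w)
      then show thesis
        using y_out nb that by auto
    next
      case (Inr f)
      then have f: "f \<in> uedges G" "adjacent_edges g f" "f \<inter> e = {}"
        using y_out nb by auto
      then obtain w where "w \<in> g" "w \<in> f"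
        by (auto simp: adjacent_edges_def)
      then show thesis
        using f g(1) uedges_subset_pverts that by blast
    qed
    moreover from this have "adjacent_edges g f"
      using g(2) by (auto simp: adjacent_edges_def)
    ultimately have "{Inl w, Inr f} \<subseteq> nbhd (middle_graph G) x - meeting_region e"
      using nb Inr by auto
    then show False using y by auto
  qed
qed

lemma closed_nbhd_edge_subset_meeting_region:
  assumes "e \<in> uedges G"
  shows "closed_nbhd (middle_graph G) (Inr e) \<subseteq> meeting_region e"
proof
  fix x
  assume "x \<in> closed_nbhd (middle_graph G) (Inr e)"
  then show "x \<in> meeting_region e"
    using uedges_subset_pverts[OF assms]
    by (cases x) (auto simp: closed_nbhd_edge_iff[OF assms])
qed

lemma closed_nbhd_end_subset_meeting_region:
  assumes "e \<in> uedges G" "v \<in> e"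
  shows "closed_nbhd (middle_graph G) (Inl v) \<subseteq> meeting_region e"
proof -
  have "v \<in> pverts G" using assms uedges_subset_pverts by blast
  then show ?thesis
    using assms by (auto simp: closed_nbhd_def nbhd_middle_graph_vertex)
qed

lemma universal_edge_if_meeting_region_full:
  assumes "e \<in> uedges G" "pverts (middle_graph G) \<subseteq> meeting_region e"
  shows "universal_edge G e"
  using assms by (auto simp: universal_edge_iff_meets_all pverts_middle_graph)

section \<open>Domination by a universal edge\<close>

lemma universal_edge_power_dominating:
  assumes univ: "universal_edge G e"
    and on_edge: "\<And>v. v \<in> pverts G \<Longrightarrow> \<exists>f\<in>uedges G. v \<in> f"
  shows "power_dominating (middle_graph G) {Inr e}"
proof -
  interpret M: pair_graph "middle_graph G" by (rule middle_graph_pair_graph)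
  have e: "e \<in> uedges G" and meets: "\<And>f. f \<in> uedges G \<Longrightarrow> f \<inter> e \<noteq> {}"
    using univ by (auto simp: universal_edge_iff_meets_all)
  have "pverts (middle_graph G) \<subseteq> C"
    if obs: "closed_nbhd (middle_graph G) (Inr e) \<subseteq> C" and st: "stuck (middle_graph G) C" for C
  proof -
    have edges: "Inr f \<in> C" if "f \<in> uedges G" for f
      using subsetD[OF obs, of "Inr f"] that meets by (simp add: closed_nbhd_edge_iff[OF e])
    have ends: "Inl v \<in> C" if "v \<in> e" for v
      using subsetD[OF obs, of "Inl v"] that by (simp add: closed_nbhd_edge_iff[OF e])
    have "Inl w \<in> C" if w: "w \<in> pverts G" for w
    proof (rule ccontr)
      assume w_out: "Inl w \<notin> C"
      obtain f where f: "f \<in> uedges G" "w \<in> f" using on_edge[OF w] by blast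
      then obtain x where x: "f = {w, x}" by (auto simp: uedges_def)
      have "x \<in> e" using meets[OF f(1)] x w_out ends by auto
      then have "nbhd (middle_graph G) (Inr f) - C = {Inl w}"
        unfolding nbhd_middle_graph_edge[OF f(1)] using w w_out x edges ends by auto
      then show False using st edges[OF f(1)] by (auto simp: stuck_def)
    qed
    then show ?thesis using edges by (auto simp: pverts_middle_graph)
  qed
  then show ?thesis
    using e by (simp add: M.power_dominating_iff_stuck pverts_middle_graph)
qed

end

section \<open>The characterization\<close>

theorem theorem46:
  fixes G :: "'a pair_pre_digraph"
  assumes "pair_graph G"
    and "connected G"
    and "card (pverts G) \<ge> 2"
  shows "power_domination_number (middle_graph G) = 1 \<longleftrightarrow> (\<exists>e. universal_edge G e)"
proof -
  interpret G: pair_graph G by (rule assms(1))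
  interpret M: pair_graph "middle_graph G" by (rule G.middle_graph_pair_graph)
  have on_edge: "\<exists>e\<in>uedges G. v \<in> e" if "v \<in> pverts G" for v
    using G.vertex_on_edge[OF assms(2,3) that] by blast
  have "pverts (middle_graph G) \<noteq> {}"
    using assms(3) by (auto simp: pverts_middle_graph)
  then have "power_domination_number (middle_graph G) = 1 \<longleftrightarrow>
      (\<exists>x. power_dominating (middle_graph G) {x})"
    by (rule M.power_domination_number_eq_1_iff)
  also have "\<dots> \<longleftrightarrow> (\<exists>e. universal_edge G e)"
  proof
    assume "\<exists>x. power_dominating (middle_graph G) {x}"
    then obtain x where x: "x \<in> pverts (middle_graph G)"
      and dom: "\<And>C. closed_nbhd (middle_graph G) x \<subseteq> C \<Longrightarrow> stuck (middle_graph G) C \<Longrightarrow>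
        pverts (middle_graph G) \<subseteq> C"
      unfolding M.power_dominating_iff_stuck by auto
    obtain e where "e \<in> uedges G" "closed_nbhd (middle_graph G) x \<subseteq> G.meeting_region e"
    proof (cases x)
      case (Inl v)
      then have "v \<in> pverts G"
        using x by (auto simp: pverts_middle_graph)
      then show thesis
        using Inl on_edge G.closed_nbhd_end_subset_meeting_region that by metis
    next
      case (Inr e)
      then have "e \<in> uedges G"
        using x by (auto simp: pverts_middle_graph)
      then show thesis
        using Inr G.closed_nbhd_edge_subset_meeting_region that by simp
    qed
    then have "universal_edge G e"
      by (intro G.universal_edge_if_meeting_region_full dom G.stuck_meeting_region)
    then show "\<exists>e. universal_edge G e" ..
  next
    assume "\<exists>e. universal_edge G e"
    then obtain e where "universal_edge G e" ..
    then have "power_dominating (middle_graph G) {Inr e}"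
      using on_edge by (rule G.universal_edge_power_dominating)
    then show "\<exists>x. power_dominating (middle_graph G) {x}" ..
  qed
  finally show ?thesis .
qed

end
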